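(* Let $\Omega$ be a semigroup and let $A$ and $M$ be two vector spaces over a field ${\bf k}$ of characteristic $0$. Suppose there are linear maps $$\mu:A\otimes A\rightarrow A,\quad l:A\otimes M\rightarrow M,\quad r:M\otimes A\rightarrow M$$ and a collection of linear maps $R=\{R_\alpha:M\rightarrow A\}_{\alpha\in\Omega}$ labelled by the elements of $\Omega$. Then the triple $\big((A,\mu),(M,l,r),\{R_\alpha\}_{\alpha\in\Omega}\big)$ is a relative Rota-Baxter family algebra if and only if $(s^{-1}\triangle,R)\in(s^{-1}\mathfrak{h}'\oplus\mathfrak{a})_0$ is a Maurer-Cartan element in the $L_\infty$-algebra $(s^{-1}\mathfrak{h}'\oplus\mathfrak{a},\{l_k\}_{k\geq1})$ described in the context, where $\triangle=\mu+l+r$.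
   Context: All vector spaces and linear maps are over a field ${\bf k}$ of characteristic $0$; $\Omega$ is a semigroup. Associative algebras are not assumed unital. A relative Rota-Baxter family algebra is a triple $(A,M,\{R_\alpha\}_{\alpha\in\Omega})$ consisting of an associative algebra $A=(A,\mu)$, $\mu(a,b)=a\cdot b$, an $A$-bimodule $M=(M,l,r)$ with left action $l(a,u)=a\cdot_M u$ and right action $r(u,a)=u\cdot_M a$, and linear maps $R_\alpha:M\to A$ ($\alpha\in\Omega$) satisfying $R_\alpha(u)\cdot R_\beta(v)=R_{\alpha\beta}\big(R_\alpha(u)\cdot_M v+u\cdot_M R_\beta(v)\big)$ for all $u,v\in M$, $\alpha,\beta\in\Omega$. $\Omega$-Gerstenhaber bracket. For a vector space $V$ and $n\geq1$, $\mathrm{Hom}_\Omega(V^{\otimes n},V)$ is the vector space of collections $f=\{f_{\alpha_1,\ldots,\alpha_n}:V^{\otimes n}\to V\}_{\alpha_1,\ldots,\alpha_n\in\Omega}$ of linear maps (and similarly $\mathrm{Hom}_\Omega(W,W')$ for $W$ a summand of $V^{\otimes n}$, $W'$ a summand of $V$). For $f\in\mathrm{Hom}_\Omega(V^{\otimes m},V)$, $g\in\mathrm{Hom}_\Omega(V^{\otimes n},V)$ and $1\leq i\leq m$, $$(f\circ_i g)_{\alpha_1,\ldots,\alpha_{m+n-1}}(v_1,\ldots,v_{m+n-1})=f_{\alpha_1,\ldots,\alpha_{i-1},\alpha_i\cdots\alpha_{i+n-1},\alpha_{i+n},\ldots,\alpha_{m+n-1}}\big(v_1,\ldots,v_{i-1},g_{\alpha_i,\ldots,\alpha_{i+n-1}}(v_i,\ldots,v_{i+n-1}),v_{i+n},\ldots,v_{m+n-1}\big)$$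 (here $\alpha_i\cdots\alpha_{i+n-1}$ is the product in $\Omega$), and $$[f,g]_\Omega=\sum_{i=1}^m(-1)^{(i-1)(n-1)}f\circ_i g-(-1)^{(m-1)(n-1)}\sum_{i=1}^n(-1)^{(i-1)(m-1)}g\circ_i f.$$ With $\mathrm{Hom}_\Omega(V^{\otimes n+1},V)$ in degree $n$ this is a graded Lie algebra. Put $\mathfrak{g}=\oplus_{n\geq0}\mathrm{Hom}_\Omega((A\oplus M)^{\otimes n+1},A\oplus M)$ with the bracket $[~,~]_\Omega$. The $L_\infty$-algebra. For $k,l\geq0$, $\mathcal{A}^{k,l}$ is the direct sum of all $(k+l)$-fold tensor products of copies of $A$ and $M$ in which $A$ appears $k$ times and $M$ appears $l$ times. Let $\mathfrak{a}=\oplus_{n\geq0}\mathfrak{a}_n\subset\mathfrak{g}$ with $\mathfrak{a}_n=\mathrm{Hom}_\Omega(M^{\otimes n+1},A)$ in degree $n$, and let $P:\mathfrak{g}\to\mathfrak{g}$ be the projection onto $\mathfrak{a}$ that kills all the other components $\mathrm{Hom}_\Omega(\mathcal{A}^{k,l},A)$ with $k\geq1$ and $\mathrm{Hom}_\Omega(\mathcal{A}^{k,l},M)$. Let $\mathfrak{h}'=\oplus_{n\geq0}\mathfrak{h}'_n$ with $\mathfrak{h}'_n=\mathrm{Hom}(A^{\otimes n+1},A)\oplus\mathrm{Hom}(\mathcal{A}^{n,1},M)\subset\mathrm{Hom}((A\oplus M)^{\otimes n+1},A\oplus M)$ (ordinary, unlabelled, linear maps) in degree $n$. For an ordinary linear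 map $f:(A\oplus M)^{\otimes n+1}\to A\oplus M$, $\widetilde f$ is the constant collection $(\widetilde f)_{\alpha_1,\ldots,\alpha_{n+1}}=f$. For $q,q'\in\mathfrak{h}'$, $[\widetilde q,\widetilde{q'}]_\Omega$ lies in the image of $\mathfrak{h}'$ under $q\mapsto\widetilde q$ and is identified with the corresponding element of $\mathfrak{h}'$. $s^{-1}$ denotes desuspension: $(s^{-1}\mathfrak{h}')_n=\mathfrak{h}'_{n+1}$. The graded vector space $s^{-1}\mathfrak{h}'\oplus\mathfrak{a}$ is an $L_\infty$-algebra (with graded symmetric degree $1$ operations $l_k$) whose operations are $$l_2(s^{-1}q,s^{-1}q')=(-1)^{|q|}s^{-1}[\widetilde q,\widetilde{q'}]_\Omega,\qquad l_k(s^{-1}q,p_1,\ldots,p_{k-1})=P[\cdots[[\widetilde q,p_1]_\Omega,p_2]_\Omega,\ldots,p_{k-1}]_\Omega\ (k\geq2),$$ for homogeneous $q,q'\in\mathfrak{h}'$, $p_1,\ldots,p_{k-1}\in\mathfrak{a}$; up to permutations of these inputs all other maps vanish. Here $\triangle=\mu+l+r\in\mathfrak{h}'_1$ and $R\in\mathfrak{a}_0$. A Maurer-Cartan element of an $L_\infty$-algebra $(\mathfrak{L},\{l_k\})$ is $\theta\in\mathfrak{L}_0$ with $\sum_{k=1}^\infty\frac{1}{k!}l_k(\theta,\ldots,\theta)=0$ (for elements $\theta\in (s^{-1}\mathfrak{h}'\oplus\mathfrak{a})_0$ here the sum has only finitely many nonzero terms). *)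

theory Defs
  imports "HOL-Analysis.Product_Vector" "HOL-Library.Function_Algebras"
begin

section \<open>Relative Rota-Baxter family algebras\<close>

definition bilinear_map ::
  "('k::field \<Rightarrow> 'a::ab_group_add \<Rightarrow> 'a) \<Rightarrow> ('k \<Rightarrow> 'b::ab_group_add \<Rightarrow> 'b) \<Rightarrow>
   ('k \<Rightarrow> 'c::ab_group_add \<Rightarrow> 'c) \<Rightarrow> ('a \<Rightarrow> 'b \<Rightarrow> 'c) \<Rightarrow> bool" where
  "bilinear_map s1 s2 s3 f \<longleftrightarrow>
     (\<forall>x. Vector_Spaces.linear s2 s3 (\<lambda>y. f x y)) \<and>
     (\<forall>y. Vector_Spaces.linear s1 s3 (\<lambda>x. f x y))"

definition associative_algebra ::
  "('k::field \<Rightarrow> 'a::ab_group_add \<Rightarrow> 'a) \<Rightarrow> ('a \<Rightarrow> 'a \<Rightarrow> 'a) \<Rightarrow> bool" where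
  "associative_algebra sA \<mu> \<longleftrightarrow>
     bilinear_map sA sA sA \<mu> \<and> (\<forall>a b c. \<mu> (\<mu> a b) c = \<mu> a (\<mu> b c))"

definition bimodule ::
  "('k::field \<Rightarrow> 'a::ab_group_add \<Rightarrow> 'a) \<Rightarrow> ('k \<Rightarrow> 'm::ab_group_add \<Rightarrow> 'm) \<Rightarrow>
   ('a \<Rightarrow> 'a \<Rightarrow> 'a) \<Rightarrow> ('a \<Rightarrow> 'm \<Rightarrow> 'm) \<Rightarrow> ('m \<Rightarrow> 'a \<Rightarrow> 'm) \<Rightarrow> bool" where
  "bimodule sA sM \<mu> l r \<longleftrightarrow>
     bilinear_map sA sM sM l \<and> bilinear_map sM sA sM r \<and>
     (\<forall>a b u. l (\<mu> a b) u = l a (l b u)) \<and>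
     (\<forall>a u b. r (l a u) b = l a (r u b)) \<and>
     (\<forall>u a b. r (r u a) b = r u (\<mu> a b))"

definition relative_Rota_Baxter_family_algebra ::
  "('k::field \<Rightarrow> 'a::ab_group_add \<Rightarrow> 'a) \<Rightarrow> ('k \<Rightarrow> 'm::ab_group_add \<Rightarrow> 'm) \<Rightarrow>
   ('a \<Rightarrow> 'a \<Rightarrow> 'a) \<Rightarrow> ('a \<Rightarrow> 'm \<Rightarrow> 'm) \<Rightarrow> ('m \<Rightarrow> 'a \<Rightarrow> 'm) \<Rightarrow>
   ('w::semigroup_mult \<Rightarrow> 'm \<Rightarrow> 'a) \<Rightarrow> bool" where
  "relative_Rota_Baxter_family_algebra sA sM \<mu> l r R \<longleftrightarrow>
     associative_algebra sA \<mu> \<and> bimodule sA sM \<mu> l r \<and>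
     (\<forall>\<alpha>. Vector_Spaces.linear sM sA (R \<alpha>)) \<and>
     (\<forall>\<alpha> \<beta> u v. \<mu> (R \<alpha> u) (R \<beta> v) = R (\<alpha> * \<beta>) (l (R \<alpha> u) v + r u (R \<beta> v)))"


section \<open>Multilinear maps, labelled collections and the bracket\<close>

text \<open>
  A linear map on the n-fold tensor power of V is encoded as an n-linear function on lists of
  length n, extended by 0 to lists of any other length. A collection labelled by n-tuples of
  elements of the semigroup takes the list of labels as its first argument, again with the value 0
  when that list does not have length n. With this convention equality of functions is equality of
  maps, respectively of collections; sums and 0 are pointwise.
\<close>

type_synonym 'v mmap = "'v list \<Rightarrow> 'v"
type_synonym ('w, 'v) coll = "'w list \<Rightarrow> 'v mmap"

definition Hom_power ::
  "('k::field \<Rightarrow> 'v::ab_group_add \<Rightarrow> 'v) \<Rightarrow> nat \<Rightarrow> 'v mmap set" where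
  "Hom_power s n = {f.
     (\<forall>vs. length vs \<noteq> n \<longrightarrow> f vs = 0) \<and>
     (\<forall>vs i. length vs = n \<longrightarrow> i < n \<longrightarrow> Vector_Spaces.linear s s (\<lambda>x. f (vs[i := x])))}"

definition collections :: "nat \<Rightarrow> 'v::zero mmap set \<Rightarrow> ('w, 'v) coll set" where
  "collections n H = {f. \<forall>ws. if length ws = n then f ws \<in> H else (\<forall>vs. f ws vs = 0)}"

definition signed :: "int \<Rightarrow> 'x::ab_group_add \<Rightarrow> 'x" where
  "signed e x = (if even e then x else - x)"

text \<open>The product of a nonempty list of labels; there is no unit for the empty list.\<close>

definition label_prod :: "'w::semigroup_mult list \<Rightarrow> 'w" where
  "label_prod ws = foldl (*) (hd ws) (tl ws)"

text \<open>
  Here m and n are the arities of f and g (so the degrees are m - 1 and n - 1), both at least 1.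
\<close>

definition circ ::
  "nat \<Rightarrow> nat \<Rightarrow> nat \<Rightarrow> ('w::semigroup_mult, 'v::ab_group_add) coll \<Rightarrow> ('w, 'v) coll \<Rightarrow>
   ('w, 'v) coll" where
  "circ m n i f g = (\<lambda>ws vs.
     if length ws = m + n - 1 \<and> length vs = m + n - 1
     then f (take (i - 1) ws @ [label_prod (take n (drop (i - 1) ws))] @ drop (i - 1 + n) ws)
            (take (i - 1) vs @ [g (take n (drop (i - 1) ws)) (take n (drop (i - 1) vs))]
               @ drop (i - 1 + n) vs)
     else 0)"

definition bracket ::
  "nat \<Rightarrow> nat \<Rightarrow> ('w::semigroup_mult, 'v::ab_group_add) coll \<Rightarrow> ('w, 'v) coll \<Rightarrow>
   ('w, 'v) coll" where
  "bracket m n f g =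
     (\<Sum>i = 1..m. signed (int ((i - 1) * (n - 1))) (circ m n i f g)) -
     signed (int ((m - 1) * (n - 1)))
       (\<Sum>i = 1..n. signed (int ((i - 1) * (m - 1))) (circ n m i g f))"

definition tilde :: "'v::zero mmap \<Rightarrow> ('w, 'v) coll" where
  "tilde f = (\<lambda>ws vs. if length ws = length vs then f vs else 0)"

text \<open>
  The identification of a constant collection with the unlabelled map it comes from. It is only
  applied to collections in the range of the injective map \<^const>\<open>tilde\<close>,
  see the lemmas below.
\<close>

definition untilde :: "('w, 'v::zero) coll \<Rightarrow> 'v mmap" where
  "untilde = inv tilde"

lemma inj_tilde: "inj (tilde :: 'v::zero mmap \<Rightarrow> ('w, 'v) coll)"
proof (rule injI, rule ext)
  fix f g :: "'v mmap" and vs :: "'v list"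
  assume eq: "(tilde f :: ('w, 'v) coll) = tilde g"
  define ws :: "'w list" where "ws = replicate (length vs) undefined"
  have "tilde f ws vs = tilde g ws vs"
    using eq by simp
  then show "f vs = g vs"
    by (simp add: tilde_def ws_def)
qed

lemma bracket_tilde_in_range:
  fixes f g :: "'v::ab_group_add mmap"
  assumes "m \<ge> 1" "n \<ge> 1"
  shows "bracket m n (tilde f :: ('w::semigroup_mult, 'v) coll) (tilde g) \<in> range tilde"
proof -
  have circ: "\<exists>h. circ a b i (tilde p) (tilde q) = (tilde h :: ('w, 'v) coll)"
    if "i \<in> {1..a}" "b \<ge> 1" for a b i and p q :: "'v mmap"
    using that
    by (intro exI[of _ "\<lambda>vs. if length vs = a + b - 1
          then p (take (i - 1) vs @ [q (take b (drop (i - 1) vs))] @ drop (i - 1 + b) vs) else 0"])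
       (auto simp: circ_def tilde_def fun_eq_iff)
  have sg: "\<exists>h. signed e F = tilde h" if "\<exists>h. F = tilde h" for e and F :: "('w, 'v) coll"
  proof -
    from that obtain h where "F = tilde h" by blast
    then show ?thesis
      by (intro exI[of _ "signed e h"]) (auto simp: signed_def tilde_def fun_eq_iff)
  qed
  have df: "\<exists>h. F - G = tilde h" if "\<exists>h. F = tilde h" "\<exists>h. G = tilde h"
    for F G :: "('w, 'v) coll"
  proof -
    from that obtain h h' where "F = tilde h" "G = tilde h'" by blast
    then show ?thesis
      by (intro exI[of _ "h - h'"]) (auto simp: tilde_def fun_eq_iff)
  qed
  have sm: "\<exists>h. sum F I = tilde h" if "finite I" "\<And>i. i \<in> I \<Longrightarrow> \<exists>h. F i = tilde h"
    for F :: "nat \<Rightarrow> ('w, 'v) coll" and I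
    using that
  proof (induction I rule: finite_induct)
    case empty
    show ?case by (intro exI[of _ 0]) (auto simp: tilde_def fun_eq_iff)
  next
    case (insert i I)
    then obtain h h' where "F i = tilde h" "sum F I = tilde h'" by blast
    with insert.hyps show ?case
      by (intro exI[of _ "h + h'"]) (auto simp: tilde_def fun_eq_iff)
  qed
  have "\<exists>h. bracket m n (tilde f :: ('w, 'v) coll) (tilde g) = tilde h"
    unfolding bracket_def using assms by (intro df sg sm circ) auto
  then show ?thesis by auto
qed

lemma untilde_tilde: "untilde (tilde f :: ('w, 'v::zero) coll) = f"
  by (simp add: untilde_def inj_tilde)


section \<open>The graded pieces for the direct sum of A and M\<close>

definition tensor_words :: "nat \<Rightarrow> nat \<Rightarrow> ('a::zero \<times> 'm::zero) list set" where
  "tensor_words k l = {vs. length vs = k + l \<and>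
     (\<exists>S \<subseteq> {..<k + l}. card S = l \<and>
        (\<forall>i < k + l. if i \<in> S then fst (vs ! i) = 0 else snd (vs ! i) = 0))}"

abbreviation A_part :: "('a::zero \<times> 'm::zero) set" where
  "A_part \<equiv> {v. snd v = 0}"

abbreviation M_part :: "('a::zero \<times> 'm::zero) set" where
  "M_part \<equiv> {v. fst v = 0}"

text \<open>
  Linear maps from the sum of all (k+l)-fold tensor products of k copies of A and l copies of M
  into a summand W, regarded as maps on the full tensor power that vanish on the other summands.
\<close>

definition Hom_summand ::
  "('k::field \<Rightarrow> 'a::ab_group_add \<Rightarrow> 'a) \<Rightarrow> ('k \<Rightarrow> 'm::ab_group_add \<Rightarrow> 'm) \<Rightarrow>
   nat \<Rightarrow> nat \<Rightarrow> ('a \<times> 'm) set \<Rightarrow> ('a \<times> 'm) mmap set" where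
  "Hom_summand sA sM k l W = {f \<in> Hom_power (module_prod.scale sA sM) (k + l).
     (\<forall>vs. f vs \<in> W) \<and>
     (\<forall>k' l'. k' + l' = k + l \<and> (k', l') \<noteq> (k, l) \<longrightarrow> (\<forall>vs \<in> tensor_words k' l'. f vs = 0))}"

definition frak_a ::
  "('k::field \<Rightarrow> 'a::ab_group_add \<Rightarrow> 'a) \<Rightarrow> ('k \<Rightarrow> 'm::ab_group_add \<Rightarrow> 'm) \<Rightarrow>
   nat \<Rightarrow> ('w, 'a \<times> 'm) coll set" where
  "frak_a sA sM n = collections (n + 1) (Hom_summand sA sM 0 (n + 1) A_part)"

definition frak_h' ::
  "('k::field \<Rightarrow> 'a::ab_group_add \<Rightarrow> 'a) \<Rightarrow> ('k \<Rightarrow> 'm::ab_group_add \<Rightarrow> 'm) \<Rightarrow>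
   nat \<Rightarrow> ('a \<times> 'm) mmap set" where
  "frak_h' sA sM n =
     {f + g | f g. f \<in> Hom_summand sA sM (n + 1) 0 A_part \<and> g \<in> Hom_summand sA sM n 1 M_part}"

definition proj_a :: "('w, 'a::ab_group_add \<times> 'm::ab_group_add) coll \<Rightarrow> ('w, 'a \<times> 'm) coll" where
  "proj_a f = (\<lambda>ws vs. (fst (f ws (map (\<lambda>v. (0, snd v)) vs)), 0))"


section \<open>The graded vector space and its operations\<close>

text \<open>
  An element of degree i is a pair (q, p): the desuspension of q, which has degree i + 1 in the
  unsuspended space, together with p of degree i. The degrees start at -1.
\<close>

type_synonym ('w, 'a, 'm) linf = "('a \<times> 'm) mmap \<times> ('w, 'a \<times> 'm) coll"

definition linf_space ::
  "('k::field \<Rightarrow> 'a::ab_group_add \<Rightarrow> 'a) \<Rightarrow> ('k \<Rightarrow> 'm::ab_group_add \<Rightarrow> 'm) \<Rightarrow>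
   int \<Rightarrow> ('w, 'a, 'm) linf set" where
  "linf_space sA sM i =
     (if i \<ge> -1 then frak_h' sA sM (nat (i + 1)) else {0}) \<times>
     (if i \<ge> 0 then frak_a sA sM (nat i) else {0})"

definition linf_scale ::
  "('k::field \<Rightarrow> 'a::ab_group_add \<Rightarrow> 'a) \<Rightarrow> ('k \<Rightarrow> 'm::ab_group_add \<Rightarrow> 'm) \<Rightarrow>
   'k \<Rightarrow> ('w, 'a, 'm) linf \<Rightarrow> ('w, 'a, 'm) linf" where
  "linf_scale sA sM c x =
     (\<lambda>vs. module_prod.scale sA sM c (fst x vs), \<lambda>ws vs. module_prod.scale sA sM c (snd x ws vs))"

text \<open>
  Iterated bracket of F, of degree d, with the entries p of the list, each given with its degree.
\<close>

fun nested_bracket ::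
  "nat \<Rightarrow> ('w::semigroup_mult, 'v::ab_group_add) coll \<Rightarrow> (nat \<times> ('w, 'v) coll) list \<Rightarrow>
   ('w, 'v) coll" where
  "nested_bracket d F [] = F"
| "nested_bracket d F ((e, p) # ps) = nested_bracket (d + e) (bracket (d + 1) (e + 1) F p) ps"

text \<open>
  The operations as families indexed by the list ds of the degrees of the inputs xs. By
  multilinearity an operation on pairs is the sum over all choices of one component in each input.
  Nonzero contributions come from the choices with exactly one q (at position j below; the Koszul
  sign is the one for moving it to the front), and, for two inputs, from the choice of both q's.
\<close>

definition linf_op ::
  "int list \<Rightarrow> ('w::semigroup_mult, 'a::ab_group_add, 'm::ab_group_add) linf list \<Rightarrow>
   ('w, 'a, 'm) linf" where
  "linf_op ds xs =
     (if length xs = 2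
      then signed (ds ! 0 + 1)
             (untilde (bracket (nat (ds ! 0 + 2)) (nat (ds ! 1 + 2))
                (tilde (fst (xs ! 0)) :: ('w, 'a \<times> 'm) coll) (tilde (fst (xs ! 1)))))
      else 0,
      if length xs \<ge> 2
      then \<Sum>j < length xs. signed (ds ! j * (\<Sum>i < j. ds ! i))
             (proj_a (nested_bracket (nat (ds ! j + 1)) (tilde (fst (xs ! j)))
                (map (\<lambda>i. (nat (ds ! i), snd (xs ! i))) ([0..<j] @ [j + 1..<length xs]))))
      else 0)"


section \<open>Maurer-Cartan elements\<close>

text \<open>
  L is the grading, s the scalar multiplication and op the family of operations, indexed by the
  list of input degrees. The series is required to have finitely many nonzero terms.
\<close>

definition maurer_cartan ::
  "('k::field_char_0 \<Rightarrow> 'x::ab_group_add \<Rightarrow> 'x) \<Rightarrow> (int \<Rightarrow> 'x set) \<Rightarrow>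
   (int list \<Rightarrow> 'x list \<Rightarrow> 'x) \<Rightarrow> 'x \<Rightarrow> bool" where
  "maurer_cartan s L op \<theta> \<longleftrightarrow> \<theta> \<in> L 0 \<and>
     (let t = \<lambda>k. s (1 / fact k) (op (replicate k 0) (replicate k \<theta>));
          K = {k. k \<ge> 1 \<and> t k \<noteq> 0}
      in finite K \<and> (\<Sum>k \<in> K. t k) = 0)"


section \<open>The element given by the structure maps\<close>

text \<open>The sum of mu, l and r, each extended by zero.\<close>

definition triangle ::
  "('a::ab_group_add \<Rightarrow> 'a \<Rightarrow> 'a) \<Rightarrow> ('a \<Rightarrow> 'm::ab_group_add \<Rightarrow> 'm) \<Rightarrow> ('m \<Rightarrow> 'a \<Rightarrow> 'm) \<Rightarrow>
   ('a \<times> 'm) mmap" where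
  "triangle \<mu> l r = (\<lambda>vs. case vs of
       [(a, u), (b, v)] \<Rightarrow> (\<mu> a b, l a v + r u b)
     | _ \<Rightarrow> 0)"

definition family_coll ::
  "('w \<Rightarrow> 'm::ab_group_add \<Rightarrow> 'a::ab_group_add) \<Rightarrow> ('w, 'a \<times> 'm) coll" where
  "family_coll R = (\<lambda>ws vs. case (ws, vs) of
       ([\<alpha>], [(a, u)]) \<Rightarrow> (R \<alpha> u, 0)
     | _ \<Rightarrow> 0)"

end

theory Submission
  imports Defs
begin

text \<open>
  Write \<open>\<Delta>\<close> for the constant collection of \<open>\<mu> + l + r\<close>. The bracket \<open>[\<Delta>, \<Delta>]\<close> is twice the
  difference of the two ways of composing \<open>\<Delta>\<close> with itself, so it vanishes exactly when \<open>\<mu>\<close> is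
  associative and \<open>M\<close> is a bimodule. A bracket with \<open>R\<close> either trades an input from \<open>A\<close> for one
  from \<open>M\<close> or moves the output from \<open>M\<close> to \<open>A\<close>, and \<open>\<Delta>\<close> allows two such moves in total. Hence
  \<open>[\<Delta>, R]\<close> has no component in \<open>Hom(M \<otimes> M, A)\<close>, while \<open>[[\<Delta>, R], R]\<close> lies in this space (it is
  twice the defect of the Rota-Baxter identity), and \<open>[[[\<Delta>, R], R], R] = 0\<close>. So the Maurer-Cartan
  series has only terms of order 2 and 3, and they lie in different summands.
\<close>

section \<open>Brackets of low arity on explicit lists\<close>

lemma list_length_two: "length xs = 2 \<longleftrightarrow> (\<exists>x y. xs = [x, y])"
  by (auto simp: numeral_2_eq_2 length_Suc_conv)

lemma list_length_three: "length xs = 3 \<longleftrightarrow> (\<exists>x y z. xs = [x, y, z])"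
  by (auto simp: numeral_3_eq_3 length_Suc_conv)

lemma signed_zero [simp]: "signed 0 x = x"
  and signed_one [simp]: "signed 1 x = - x"
  by (simp_all add: signed_def)

text \<open>Only meaningful for \<open>F\<close> of arity 2 and \<open>p\<close> of arity 1, hence degree 0: the arity of \<open>F\<close> persists.\<close>

definition ad ::
  "('w::semigroup_mult, 'v::ab_group_add) coll \<Rightarrow> ('w, 'v) coll \<Rightarrow> ('w, 'v) coll" where
  "ad p F = bracket 2 1 F p"

text \<open>As \<open>p\<close> has arity 1, every sign exponent in the bracket is 0.\<close>

lemma ad_apply:
  "ad p F [\<alpha>, \<beta>] [x, y] =
     F [\<alpha>, \<beta>] [p [\<alpha>] [x], y] + F [\<alpha>, \<beta>] [x, p [\<beta>] [y]] - p [\<alpha> * \<beta>] [F [\<alpha>, \<beta>] [x, y]]"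
  by (simp add: ad_def bracket_def circ_def label_prod_def numeral_2_eq_2)

lemma ad_outside:
  "length ws \<noteq> 2 \<or> length vs \<noteq> 2 \<Longrightarrow> ad p F ws vs = 0"
  by (auto simp: ad_def bracket_def circ_def numeral_2_eq_2)

text \<open>The factor (-1)^(1*1) turns the subtraction of the second sum into an addition, so both
  sums contribute the same associator. It is repeated instead of doubled because \<open>'v\<close>
  carries no scalar multiplication here.\<close>

lemma bracket_2_2_apply:
  "bracket 2 2 F F [\<alpha>, \<beta>, \<gamma>] [x, y, z] =
     (F [\<alpha> * \<beta>, \<gamma>] [F [\<alpha>, \<beta>] [x, y], z] - F [\<alpha>, \<beta> * \<gamma>] [x, F [\<beta>, \<gamma>] [y, z]]) +
     (F [\<alpha> * \<beta>, \<gamma>] [F [\<alpha>, \<beta>] [x, y], z] - F [\<alpha>, \<beta> * \<gamma>] [x, F [\<beta>, \<gamma>] [y, z]])"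
  by (simp add: bracket_def circ_def label_prod_def numeral_2_eq_2 eval_nat_numeral)

lemma bracket_2_2_outside:
  "length ws \<noteq> 3 \<or> length vs \<noteq> 3 \<Longrightarrow> bracket 2 2 F G ws vs = 0"
  by (auto simp: bracket_def circ_def numeral_2_eq_2 numeral_3_eq_3)

section \<open>The operations on equal inputs of degree 0\<close>

lemma nested_bracket_replicate:
  "nested_bracket 1 F (replicate n (0, p)) = (ad p ^^ n) F"
  \<comment> \<open>\<open>nested_bracket\<close> starts with the innermost bracket, so
    \<open>F\<close> is generalized and the power is unfolded on its inner side.\<close>
  by (induction n arbitrary: F)
    (simp_all add: ad_def funpow_Suc_right numeral_2_eq_2 del: funpow.simps(2))

text \<open>With all degrees 0 the Koszul signs are trivial and each of the \<open>k\<close>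
  positions of \<open>q\<close> contributes the same bracket. The minus sign is (-1)^|q| with |q| =
  1.\<close>

lemma linf_op_replicate:
  fixes p :: "('w::semigroup_mult, 'a::ab_group_add \<times> 'm::ab_group_add) coll"
  shows "linf_op (replicate k 0) (replicate k (q, p)) =
    (if k = 2 then - untilde (bracket 2 2 (tilde q :: ('w, 'a \<times> 'm) coll) (tilde q)) else 0,
     if k \<ge> 2 then \<Sum>j<k. proj_a ((ad p ^^ (k - 1)) (tilde q)) else 0)"
proof -
  have inputs: "map (\<lambda>i. (nat (replicate k 0 ! i), snd (replicate k (q, p) ! i)))
      ([0..<j] @ [j + 1..<length (replicate k (q, p))]) = replicate (k - 1) (0, p)"
    if "j < k" for j
    using that by (intro nth_equalityI) (auto simp: nth_append)
  have sgn: "(\<Sum>i<j. (replicate k 0 :: int list) ! i) = 0" if "j < k" for j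
    using that by (intro sum.neutral) auto
  show ?thesis
    unfolding linf_op_def
    by (auto simp: inputs[simplified] sgn nested_bracket_replicate[simplified] simp del: sum_constant
        intro!: sum.cong)
qed

text \<open>Multilinearity is common to both sides of the equivalence and is fixed here;
  associativity, the bimodule laws and the Rota-Baxter identity remain to be compared.\<close>

locale rota_baxter_data = vector_space_prod sA sM
  for sA :: "'k::field_char_0 \<Rightarrow> 'a::ab_group_add \<Rightarrow> 'a"
    and sM :: "'k \<Rightarrow> 'm::ab_group_add \<Rightarrow> 'm" +
  fixes \<mu> :: "'a \<Rightarrow> 'a \<Rightarrow> 'a"
    and l :: "'a \<Rightarrow> 'm \<Rightarrow> 'm"
    and r :: "'m \<Rightarrow> 'a \<Rightarrow> 'm"
    and R :: "'w::semigroup_mult \<Rightarrow> 'm \<Rightarrow> 'a"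
  assumes bilinear_\<mu>: "bilinear_map sA sA sA \<mu>"
    and bilinear_l: "bilinear_map sA sM sM l"
    and bilinear_r: "bilinear_map sM sA sM r"
    and linear_R: "Vector_Spaces.linear sM sA (R \<alpha>)"
begin

lemmas linearity =
  bilinear_\<mu>[unfolded bilinear_map_def Vector_Spaces.linear_iff]
  bilinear_l[unfolded bilinear_map_def Vector_Spaces.linear_iff]
  bilinear_r[unfolded bilinear_map_def Vector_Spaces.linear_iff]
  linear_R[unfolded Vector_Spaces.linear_iff]

lemma add_rules:
  "\<mu> (a + a') b = \<mu> a b + \<mu> a' b" "\<mu> a (b + b') = \<mu> a b + \<mu> a b'"
  "l (a + a') u = l a u + l a' u" "l a (u + u') = l a u + l a u'"
  "r (u + u') a = r u a + r u' a" "r u (a + a') = r u a + r u a'"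
  "R \<alpha> (u + u') = R \<alpha> u + R \<alpha> u'"
  by (simp_all add: linearity)

lemma scale_rules:
  "\<mu> (sA c a) b = sA c (\<mu> a b)" "\<mu> a (sA c b) = sA c (\<mu> a b)"
  "l (sA c a) u = sM c (l a u)" "l a (sM c u) = sM c (l a u)"
  "r (sM c u) a = sM c (r u a)" "r u (sA c a) = sM c (r u a)"
  "R \<alpha> (sM c u) = sA c (R \<alpha> u)"
  by (simp_all add: linearity)

lemma zero_rules [simp]:
  "\<mu> 0 b = 0" "\<mu> a 0 = 0" "l 0 u = 0" "l a 0 = 0" "r 0 a = 0" "r u 0 = 0" "R \<alpha> 0 = 0"
  using scale_rules(1)[of 0 0 b] scale_rules(2)[of a 0 0] scale_rules(3)[of 0 0 u]
    scale_rules(4)[of a 0 0] scale_rules(5)[of 0 0 a] scale_rules(6)[of u 0 0]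
    scale_rules(7)[of \<alpha> 0 0]
  by simp_all

abbreviation \<Delta> :: "('w, 'a \<times> 'm) coll" where
  "\<Delta> \<equiv> tilde (triangle \<mu> l r)"

abbreviation ad_R :: "('w, 'a \<times> 'm) coll \<Rightarrow> ('w, 'a \<times> 'm) coll" where
  "ad_R \<equiv> ad (family_coll R)"

abbreviation defect :: "'w \<Rightarrow> 'w \<Rightarrow> 'm \<Rightarrow> 'm \<Rightarrow> 'a" where
  "defect \<alpha> \<beta> u v \<equiv> \<mu> (R \<alpha> u) (R \<beta> v) - R (\<alpha> * \<beta>) (l (R \<alpha> u) v + r u (R \<beta> v))"

lemma \<Delta>_apply: "\<Delta> [\<alpha>, \<beta>] [x, y] = (\<mu> (fst x) (fst y), l (fst x) (snd y) + r (snd x) (fst y))"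
  by (cases x; cases y) (simp add: tilde_def triangle_def)

lemma family_coll_apply: "family_coll R [\<alpha>] [x] = (R \<alpha> (snd x), 0)"
  by (cases x) (simp add: family_coll_def)

lemma family_coll_zero: "family_coll R [\<alpha>] [0] = 0"
  by (simp add: family_coll_apply zero_prod_def)

section \<open>Iterated brackets of \<Delta> with R\<close>

lemma ad_\<Delta>:
  "ad_R \<Delta> [\<alpha>, \<beta>] [x, y] =
    (\<mu> (R \<alpha> (snd x)) (fst y) + \<mu> (fst x) (R \<beta> (snd y))
       - R (\<alpha> * \<beta>) (l (fst x) (snd y) + r (snd x) (fst y)),
     l (R \<alpha> (snd x)) (snd y) + r (snd x) (R \<beta> (snd y)))"
  by (simp add: ad_apply \<Delta>_apply family_coll_apply)

text \<open>Inserting R into \<open>ad_R \<Delta>\<close> at either input gives the product of R u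
  and R v together with one of the two terms under the outer R. The outer R applied to the
  M-component gives both of these terms once more, so the defect occurs exactly twice.\<close>

lemma ad_ad_\<Delta>:
  "ad_R (ad_R \<Delta>) [\<alpha>, \<beta>] [x, y] =
    (defect \<alpha> \<beta> (snd x) (snd y) + defect \<alpha> \<beta> (snd x) (snd y), 0)"
  by (simp add: ad_apply[where F = "ad_R \<Delta>"] ad_\<Delta> family_coll_apply add_rules)

text \<open>\<open>ad_R (ad_R \<Delta>)\<close> reads only M-components and its values lie in A,
  while R maps into A and kills A; so each of the three compositions is 0.\<close>

lemma ad_ad_ad_\<Delta>: "ad_R (ad_R (ad_R \<Delta>)) = 0"
proof (intro ext)
  fix ws :: "'w list" and vs :: "('a \<times> 'm) list"
  show "ad_R (ad_R (ad_R \<Delta>)) ws vs = 0 ws vs"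
  proof (cases "length ws = 2 \<and> length vs = 2")
    case True
    then show ?thesis
      by (auto simp: list_length_two family_coll_apply ad_ad_\<Delta> zero_prod_def
          ad_apply[where F = "ad_R (ad_R \<Delta>)"])
  qed (simp add: ad_outside)
qed

lemma ad_R_zero: "ad_R 0 = (0 :: ('w, 'a \<times> 'm) coll)"
proof (intro ext)
  fix ws :: "'w list" and vs :: "('a \<times> 'm) list"
  show "ad_R 0 ws vs = (0 :: ('w, 'a \<times> 'm) coll) ws vs"
    by (cases "length ws = 2 \<and> length vs = 2")
      (auto simp: ad_apply list_length_two family_coll_zero ad_outside)
qed

lemma funpow_ad_R_eq_0: "(ad_R ^^ (n + 3)) \<Delta> = 0"
proof -
  have "(ad_R ^^ n) 0 = 0"
    by (induction n) (simp_all only: funpow.simps comp_apply ad_R_zero id_apply)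
  then show ?thesis
    by (simp only: funpow_add comp_apply numeral_3_eq_3 funpow.simps id_apply ad_ad_ad_\<Delta>)
qed

text \<open>Each summand of the A-component in \<open>ad_\<Delta>\<close> uses the A-component of an
  input, which \<open>proj_a\<close> sets to 0.\<close>

lemma proj_ad_\<Delta>: "proj_a (ad_R \<Delta>) = 0"
proof (intro ext)
  fix ws :: "'w list" and vs :: "('a \<times> 'm) list"
  show "proj_a (ad_R \<Delta>) ws vs = 0 ws vs"
    by (cases "length ws = 2 \<and> length vs = 2")
      (auto simp: proj_a_def ad_\<Delta> list_length_two zero_prod_def ad_outside)
qed

section \<open>Vanishing brackets as algebraic identities\<close>

lemma proj_ad_ad_\<Delta>_eq_0_iff:
  "proj_a (ad_R (ad_R \<Delta>)) = 0 \<longleftrightarrow> (\<forall>\<alpha> \<beta> u v. defect \<alpha> \<beta> u v = 0)"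
  (is "?P = 0 \<longleftrightarrow> _")
proof
  assume "?P = 0"
  then have "?P [\<alpha>, \<beta>] [(0, u), (0, v)] = 0" for \<alpha> \<beta> u v
    by simp
  then have "defect \<alpha> \<beta> u v + defect \<alpha> \<beta> u v = 0" for \<alpha> \<beta> u v
    by (simp only: proj_a_def ad_ad_\<Delta> list.map fst_conv snd_conv zero_prod_def prod.inject)
  \<comment> \<open>As a multiple by the scalar 2, the doubled defect can be cancelled in
    characteristic 0.\<close>
  then have "sA 2 (defect \<alpha> \<beta> u v) = 0" for \<alpha> \<beta> u v
    using vs1.scale_left_distrib[of 1 1] by (simp only: one_add_one vs1.scale_one)
  then show "\<forall>\<alpha> \<beta> u v. defect \<alpha> \<beta> u v = 0"
    by simp
next
  assume defect: "\<forall>\<alpha> \<beta> u v. defect \<alpha> \<beta> u v = 0"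
  show "?P = 0"
  proof (intro ext)
    fix ws :: "'w list" and vs :: "('a \<times> 'm) list"
    show "?P ws vs = 0 ws vs"
      by (cases "length ws = 2 \<and> length vs = 2")
        (use defect in \<open>auto simp: proj_a_def ad_ad_\<Delta> list_length_two
          zero_prod_def ad_outside\<close>)
  qed
qed

lemma bracket_\<Delta>_\<Delta>_eq_0_iff:
  "bracket 2 2 \<Delta> \<Delta> = 0 \<longleftrightarrow> associative_algebra sA \<mu> \<and> bimodule sA sM \<mu> l r"
proof
  assume "bracket 2 2 \<Delta> \<Delta> = 0"
  then have "bracket 2 2 \<Delta> \<Delta> [\<alpha>, \<beta>, \<gamma>] [x, y, z] = 0" for \<alpha> \<beta> \<gamma> x y z
    by simp
  then have "scale 2 (\<Delta> [\<alpha> * \<beta>, \<gamma>] [\<Delta> [\<alpha>, \<beta>] [x, y], z]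
      - \<Delta> [\<alpha>, \<beta> * \<gamma>] [x, \<Delta> [\<beta>, \<gamma>] [y, z]]) = 0" for \<alpha> \<beta> \<gamma> x y z
    using p.scale_left_distrib[of 1 1] by (simp only: one_add_one p.scale_one bracket_2_2_apply)
  then have eq: "\<Delta> [\<alpha> * \<beta>, \<gamma>] [\<Delta> [\<alpha>, \<beta>] [x, y], z] = \<Delta> [\<alpha>, \<beta> * \<gamma>] [x, \<Delta> [\<beta>, \<gamma>] [y, z]]"
    for \<alpha> \<beta> \<gamma> x y z
    by (simp only: p.scale_eq_0_iff) simp
  show "associative_algebra sA \<mu> \<and> bimodule sA sM \<mu> l r"
    unfolding associative_algebra_def bimodule_def
  proof (intro conjI allI bilinear_\<mu> bilinear_l bilinear_r)
    fix a b c u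
    \<comment> \<open>The position of the one input from M, if any, selects the law; the labels are
      arbitrary.\<close>
    show "\<mu> (\<mu> a b) c = \<mu> a (\<mu> b c)"
      using eq[of _ _ _ "(a, 0)" "(b, 0)" "(c, 0)"] by (simp add: \<Delta>_apply)
    show "l (\<mu> a b) u = l a (l b u)"
      using eq[of _ _ _ "(a, 0)" "(b, 0)" "(0, u)"] by (simp add: \<Delta>_apply)
    show "r (l a u) b = l a (r u b)"
      using eq[of _ _ _ "(a, 0)" "(0, u)" "(b, 0)"] by (simp add: \<Delta>_apply)
    show "r (r u a) b = r u (\<mu> a b)"
      using eq[of _ _ _ "(0, u)" "(a, 0)" "(b, 0)"] by (simp add: \<Delta>_apply)
  qed
next
  assume alg: "associative_algebra sA \<mu> \<and> bimodule sA sM \<mu> l r"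
  show "bracket 2 2 \<Delta> \<Delta> = 0"
  proof (intro ext)
    fix ws :: "'w list" and vs :: "('a \<times> 'm) list"
    show "bracket 2 2 \<Delta> \<Delta> ws vs = 0 ws vs"
      by (cases "length ws = 3 \<and> length vs = 3")
        (use alg in \<open>auto simp: list_length_three bracket_2_2_apply \<Delta>_apply add_rules
          associative_algebra_def bimodule_def bracket_2_2_outside add_ac\<close>)
  qed
qed

text \<open>\<open>untilde\<close> is an inverse only on the range of \<open>tilde\<close>, so the
  bracket must first be exhibited as a constant collection.\<close>

lemma untilde_bracket_\<Delta>_\<Delta>_eq_0_iff:
  "untilde (bracket 2 2 \<Delta> \<Delta>) = 0 \<longleftrightarrow> associative_algebra sA \<mu> \<and> bimodule sA sM \<mu> l r"
proof -
  obtain h where h: "bracket 2 2 \<Delta> \<Delta> = tilde h"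
    using bracket_tilde_in_range[of 2 2 "triangle \<mu> l r" "triangle \<mu> l r"] by auto
  have "(tilde 0 :: ('w, 'a \<times> 'm) coll) = 0"
    by (simp add: tilde_def fun_eq_iff)
  then have "untilde (tilde h :: ('w, 'a \<times> 'm) coll) = 0 \<longleftrightarrow> (tilde h :: ('w, 'a \<times> 'm) coll) = 0"
    by (metis untilde_tilde)
  then show ?thesis
    using bracket_\<Delta>_\<Delta>_eq_0_iff by (simp add: h)
qed

section \<open>The pair lies in degree 0\<close>

lemma Hom_power_2I:
  assumes "\<And>vs. length vs \<noteq> 2 \<Longrightarrow> f vs = 0"
    and "\<And>x. Vector_Spaces.linear scale scale (\<lambda>y. f [x, y])"
    and "\<And>y. Vector_Spaces.linear scale scale (\<lambda>x. f [x, y])"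
  shows "f \<in> Hom_power scale 2"
  using assms by (auto simp: Hom_power_def list_length_two less_2_cases_iff)

text \<open>The set \<open>S\<close> of positions held by M is one of the four subsets of {0, 1}.
  The cases serve to check vanishing on the remaining summands.\<close>

lemma tensor_words_2:
  assumes "vs \<in> tensor_words k m" "k + m = 2"
  obtains x y where "vs = [x, y]" "m = 0" "snd x = 0" "snd y = 0"
  | x y where "vs = [x, y]" "m = 1" "fst x = 0" "snd y = 0"
  | x y where "vs = [x, y]" "m = 1" "snd x = 0" "fst y = 0"
  | x y where "vs = [x, y]" "m = 2" "fst x = 0" "fst y = 0"
proof -
  from assms(1) obtain S where "length vs = k + m" and S: "S \<subseteq> {..<k + m}" "card S = m"
    and "\<forall>i<k + m. if i \<in> S then fst (vs ! i) = 0 else snd (vs ! i) = 0"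
    unfolding tensor_words_def by blast
  then have zero: "\<forall>i<2. if i \<in> S then fst (vs ! i) = 0 else snd (vs ! i) = 0"
    and len: "length vs = 2"
    by (simp_all only: assms(2))
  obtain x y where vs: "vs = [x, y]"
    using len by (auto simp: list_length_two)
  have "{..<2} = {0, 1::nat}"
    by auto
  with S(1) have "S \<in> Pow {0, 1}"
    by (simp add: assms(2))
  then have "S = {} \<or> S = {0} \<or> S = {1} \<or> S = {0, 1}"
    by (auto simp: Pow_insert)
  moreover have "if 0 \<in> S then fst x = 0 else snd x = 0" "if 1 \<in> S then fst y = 0 else snd y = 0"
    using zero[rule_format, of 0] zero[rule_format, of 1]
    by (simp_all add: vs split: if_splits)
  ultimately show thesis
    using that[OF vs] S(2) by (elim disjE) (simp_all add: eval_nat_numeral)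
qed

lemma triangle_in_frak_h': "triangle \<mu> l r \<in> frak_h' sA sM 1"
proof -
  \<comment> \<open>Splitting by output: \<open>f\<close> is \<mu> and \<open>g\<close> is l + r,
    each extended by zero.\<close>
  define f :: "('a \<times> 'm) mmap" where "f vs = (fst (triangle \<mu> l r vs), 0)" for vs
  define g :: "('a \<times> 'm) mmap" where "g vs = (0, snd (triangle \<mu> l r vs))" for vs
  have outside: "triangle \<mu> l r vs = 0" if "length vs \<noteq> 2" for vs
    using that by (auto simp: triangle_def split: list.split)
  have two: "triangle \<mu> l r [x, y] = (\<mu> (fst x) (fst y), l (fst x) (snd y) + r (snd x) (fst y))"
    for x y
    by (cases x; cases y) (simp add: triangle_def)
  have f: "f \<in> Hom_power scale 2"
    by (rule Hom_power_2I)
      (auto simp: f_def outside two zero_prod_def scale_def add_rules scale_rules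
        Vector_Spaces.linear_iff p.vector_space_axioms)
  have g: "g \<in> Hom_power scale 2"
    by (rule Hom_power_2I)
      (auto simp: g_def outside two zero_prod_def scale_def add_rules scale_rules
        Vector_Spaces.linear_iff p.vector_space_axioms vs2.scale_right_distrib)
  have "f \<in> Hom_summand sA sM (1 + 1) 0 A_part"
    using f by (auto simp: Hom_summand_def f_def two zero_prod_def numeral_2_eq_2
        elim!: tensor_words_2[simplified])
  moreover have "g \<in> Hom_summand sA sM 1 1 M_part"
    using g by (auto simp: Hom_summand_def g_def two zero_prod_def numeral_2_eq_2
        elim!: tensor_words_2[simplified])
  moreover have "triangle \<mu> l r = f + g"
    by (auto simp: f_def g_def fun_eq_iff)
  ultimately show ?thesis
    unfolding frak_h'_def by blast
qed

lemma family_coll_in_frak_a: "family_coll R \<in> frak_a sA sM 0"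
proof -
  have "family_coll R [\<alpha>] \<in> Hom_summand sA sM 0 1 A_part" for \<alpha>
  proof -
    have "Vector_Spaces.linear scale scale (\<lambda>x. family_coll R [\<alpha>] [x])"
      by (simp add: family_coll_apply Vector_Spaces.linear_iff p.vector_space_axioms add_rules
          scale_rules scale_def)
    moreover have "family_coll R [\<alpha>] vs = 0" if "length vs \<noteq> 1" for vs
      using that by (auto simp: family_coll_def split: list.split)
    moreover have "snd (family_coll R [\<alpha>] vs) = 0" for vs
      by (auto simp: family_coll_def split: list.split)
    \<comment> \<open>In arity 1 the only other summand is A itself.\<close>
    moreover have "family_coll R [\<alpha>] vs = 0" if "vs \<in> tensor_words 1 0" for vs
    proof -
      from that obtain S where "length vs = 1" "S \<subseteq> {..<1}" "card S = 0"
        and S: "\<forall>i<1. if i \<in> S then fst (vs ! i) = 0 else snd (vs ! i) = 0"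
        by (auto simp: tensor_words_def)
      moreover from this have "S = {}"
        by (simp add: card_eq_0_iff finite_subset)
      ultimately show ?thesis
        using S by (auto simp: length_Suc_conv family_coll_apply zero_prod_def)
    qed
    ultimately show ?thesis
      by (auto simp: Hom_summand_def Hom_power_def length_Suc_conv add_is_1)
  qed
  moreover have "family_coll R ws vs = 0" if "length ws \<noteq> 1" for ws :: "'w list" and vs
    using that by (auto simp: family_coll_def split: list.split)
  ultimately show ?thesis
    by (auto simp: frak_a_def collections_def length_Suc_conv)
qed

section \<open>Terms of the Maurer-Cartan series\<close>

lemma linf_op_two:
  "linf_op (replicate 2 0) (replicate 2 (triangle \<mu> l r, family_coll R)) =
    (- untilde (bracket 2 2 \<Delta> \<Delta>), 0)"
  unfolding linf_op_replicate by (simp add: proj_ad_\<Delta>)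

lemma linf_op_three:
  "linf_op (replicate 3 0) (replicate 3 (triangle \<mu> l r, family_coll R)) =
    (0, \<Sum>j<(3::nat). proj_a (ad_R (ad_R \<Delta>)))"
  unfolding linf_op_replicate by (simp add: numeral_2_eq_2)

text \<open>Orders 0 and 1 vanish by the definition of \<open>linf_op\<close>; from order 4 on, at
  least three brackets with R are taken.\<close>

lemma linf_op_eq_0:
  assumes "k \<noteq> 2" "k \<noteq> 3"
  shows "linf_op (replicate k 0)
    (replicate k (triangle \<mu> l r, family_coll R :: ('w, 'a \<times> 'm) coll)) = 0"
proof (cases "k \<ge> 4")
  case True
  then have "k - 1 = (k - 4) + 3"
    by simp
  moreover have "proj_a (0 :: ('w, 'a \<times> 'm) coll) = 0"
    by (simp add: proj_a_def fun_eq_iff zero_prod_def)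
  ultimately show ?thesis
    unfolding linf_op_replicate by (simp only: funpow_ad_R_eq_0) (simp add: assms zero_prod_def)
next
  case False
  then show ?thesis
    using assms unfolding linf_op_replicate by (simp add: zero_prod_def)
qed

end

theorem theorem3p4:
  fixes sA :: "'k::field_char_0 \<Rightarrow> 'a::ab_group_add \<Rightarrow> 'a"
    and sM :: "'k \<Rightarrow> 'm::ab_group_add \<Rightarrow> 'm"
    and \<mu> :: "'a \<Rightarrow> 'a \<Rightarrow> 'a"
    and l :: "'a \<Rightarrow> 'm \<Rightarrow> 'm"
    and r :: "'m \<Rightarrow> 'a \<Rightarrow> 'm"
    and R :: "'w::semigroup_mult \<Rightarrow> 'm \<Rightarrow> 'a"
  assumes "vector_space sA" and "vector_space sM"
    and "bilinear_map sA sA sA \<mu>"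
    and "bilinear_map sA sM sM l"
    and "bilinear_map sM sA sM r"
    and "\<forall>\<alpha>. Vector_Spaces.linear sM sA (R \<alpha>)"
  shows "relative_Rota_Baxter_family_algebra sA sM \<mu> l r R \<longleftrightarrow>
    maurer_cartan (linf_scale sA sM) (linf_space sA sM) linf_op
      (triangle \<mu> l r, family_coll R)"
proof -
  interpret rota_baxter_data sA sM \<mu> l r R
    using assms by (simp add: rota_baxter_data_def rota_baxter_data_axioms_def
        vector_space_prod_def vector_space_pair_def)
  define \<theta> where "\<theta> = (triangle \<mu> l r, family_coll R)"
  define t where "t k = linf_scale sA sM (1 / fact k) (linf_op (replicate k 0) (replicate k \<theta>))" for k
  define Q where "Q = untilde (bracket 2 2 \<Delta> \<Delta>)"
  define N where "N = proj_a (ad_R (ad_R \<Delta>))"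
  have scale_0: "linf_scale sA sM c 0 = (0 :: ('w, 'a, 'm) linf)" for c
    by (simp add: linf_scale_def zero_prod_def fun_eq_iff scale_def)
  have t2: "t 2 = (\<lambda>vs. scale (- (1 / 2)) (Q vs), 0)"
    unfolding t_def \<theta>_def linf_op_two
    by (simp add: linf_scale_def Q_def[symmetric] fun_eq_iff zero_prod_def scale_def fact_numeral)
  \<comment> \<open>The three equal summands against 3! leave the coefficient 1/2.\<close>
  have sum_N: "(\<Sum>j<(3::nat). N) ws vs = scale 3 (N ws vs)" for ws vs
  proof -
    have "(\<Sum>j<(3::nat). N) ws vs = (\<Sum>j<(3::nat). N ws vs)"
      by (simp add: eval_nat_numeral)
    then show ?thesis
      by (simp only: p.sum_constant_scale) simp
  qed
  have t3: "t 3 = (0, \<lambda>ws vs. scale (1 / 2) (N ws vs))"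
    unfolding t_def \<theta>_def linf_op_three N_def[symmetric]
    by (simp add: linf_scale_def sum_N fun_eq_iff p.scale_scale fact_numeral del: sum_constant)
  have t_other: "t k = 0" if "k \<noteq> 2" "k \<noteq> 3" for k
    using that by (simp add: t_def \<theta>_def linf_op_eq_0 scale_0)
  have support: "{k. k \<ge> 1 \<and> t k \<noteq> 0} \<subseteq> {2, 3}"
    using t_other by auto
  have "\<theta> \<in> linf_space sA sM 0"
    using triangle_in_frak_h' family_coll_in_frak_a by (simp add: \<theta>_def linf_space_def)
  moreover have "finite {k. k \<ge> 1 \<and> t k \<noteq> 0}"
    using support by (rule finite_subset) simp
  moreover have "(\<Sum>k | k \<ge> 1 \<and> t k \<noteq> 0. t k) = t 2 + t 3"
  proof -
    \<comment> \<open>The support may be smaller than {2, 3}; the added terms are 0.\<close>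
    have "(\<Sum>k | k \<ge> 1 \<and> t k \<noteq> 0. t k) = sum t {2, 3}"
      using support by (intro sum.mono_neutral_left) auto
    then show ?thesis
      by simp
  qed
  moreover have "t 2 + t 3 = 0 \<longleftrightarrow> Q = 0 \<and> N = 0"
  proof -
    \<comment> \<open>The two terms occupy different components of the pair, so they cannot
      cancel.\<close>
    have "t 2 + t 3 = 0 \<longleftrightarrow>
      (\<lambda>vs. scale (- (1 / 2)) (Q vs)) = 0 \<and> (\<lambda>ws vs. scale (1 / 2) (N ws vs)) = 0"
      by (simp only: t2 t3 zero_prod_def[where 'a = "('a \<times> 'm) mmap"]
          add_Pair add_0 add_0_right prod.inject)
    then show ?thesis
      by (simp add: fun_eq_iff)
  qed
  ultimately have "maurer_cartan (linf_scale sA sM) (linf_space sA sM) linf_op \<theta> \<longleftrightarrow> Q = 0 \<and> N = 0"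
    by (simp add: maurer_cartan_def Let_def t_def)
  also have "\<dots> \<longleftrightarrow> relative_Rota_Baxter_family_algebra sA sM \<mu> l r R"
    unfolding Q_def N_def untilde_bracket_\<Delta>_\<Delta>_eq_0_iff proj_ad_ad_\<Delta>_eq_0_iff
      relative_Rota_Baxter_family_algebra_def
    using linear_R by auto
  finally show ?thesis
    by (simp add: \<theta>_def)
qed

end
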